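(* Let $R$ be a relational structure with possibly infinitely many non isomorphic types of $n$-element substructures. The age algebra $\mathbb C.{\mathcal A}(R)$ is an integral domain if and only if the kernel of $R$ is empty.
   Context: A relational structure is a pair $R:=(E,(\rho_{i})_{i\in I})$ where $E$ is a set (the base) and each $\rho_i$ is an $m_i$-ary relation on $E$; the family $(m_i)_{i\in I}$ is the signature, and $I$ may be infinite. For $A\subseteq E$, the restriction $R_{\restriction A}:=(A,(A^{m_i}\cap\rho_i)_{i\in I})$ is the substructure induced on $A$; isomorphism of relational structures with the same signature is defined in the usual way. For a non-negative integer $m$, $[E]^m$ denotes the set of $m$-element subsets of $E$. A map $f:[E]^m\rightarrow\mathbb C$ is $R$-invariant if $f(P)=f(P')$ whenever $R_{\restriction P}$ and $R_{\restriction P'}$ are isomorphic. If $f:[E]^m\rightarrow\mathbb C$ and $g:[E]^n\rightarrow\mathbb C$, their product is defined on each $(m+n)$-element subset $Q$ of $E$ by $(fg)(Q):=\sum_{P\in[Q]^m} f(P)g(Q\setminus P)$; the product of two $R$-invariant maps is $R$-invariant. The age algebra $\mathbb C.{\mathcal A}(R)$ is the $\mathbb C$-vector space spanned by the $R$-invariant maps (for all $m$), equipped with this multiplication; it is a graded algebra. The age ${\mathcal A}(R)$ of $R$ is the collection of substructures of $R$ induced on finite subsets of $E$, isomorphic substructures being identified. The kernel $K(R)$ of $R$ is the set of $x\in E$ such that ${\mathcal A}(R_{\restriction E\setminus\{x\}})\neq{\mathcal A}(R)$. *)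

theory Defs
  imports "HOL-Algebra.Module" "HOL-Library.Ramsey" Complex_Main
begin

text \<open>An \<open>m\<close>-ary relation on \<open>A\<close> is a subset of \<open>tuples A m\<close>.\<close>

definition tuples :: "'a set \<Rightarrow> nat \<Rightarrow> 'a list set" where
  "tuples A m = {xs. set xs \<subseteq> A \<and> length xs = m}"

text \<open>The index set is an explicit field, so that it may be empty. The values of \<open>arity\<close> and
  \<open>rels\<close> outside \<open>indices\<close> carry no information and are ignored throughout.\<close>

record ('a, 'i) rel_struct =
  base :: "'a set"
  indices :: "'i set"
  arity :: "'i \<Rightarrow> nat"
  rels :: "'i \<Rightarrow> 'a list set"

definition relational_structure :: "('a, 'i) rel_struct \<Rightarrow> bool" where
  "relational_structure R \<longleftrightarrow> (\<forall>i\<in>indices R. rels R i \<subseteq> tuples (base R) (arity R i))"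

definition restriction :: "('a, 'i) rel_struct \<Rightarrow> 'a set \<Rightarrow> ('a, 'i) rel_struct" where
  "restriction R A =
     R\<lparr>base := A, rels := (\<lambda>i. tuples A (arity R i) \<inter> rels R i)\<rparr>"

definition same_signature :: "('a, 'i) rel_struct \<Rightarrow> ('b, 'i) rel_struct \<Rightarrow> bool" where
  "same_signature S T \<longleftrightarrow>
     indices S = indices T \<and> (\<forall>i\<in>indices S. arity S i = arity T i)"

definition isomorphic :: "('a, 'i) rel_struct \<Rightarrow> ('b, 'i) rel_struct \<Rightarrow> bool" where
  "isomorphic S T \<longleftrightarrow> same_signature S T \<and>
     (\<exists>h. bij_betw h (base S) (base T) \<and>
          (\<forall>i\<in>indices S. \<forall>xs\<in>tuples (base S) (arity S i).
             xs \<in> rels S i \<longleftrightarrow> map h xs \<in> rels T i))"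

text \<open>Isomorphic substructures are identified by passing to isomorphism classes.\<close>

definition iso_class :: "('a, 'i) rel_struct \<Rightarrow> ('a, 'i) rel_struct set" where
  "iso_class S = {T. relational_structure T \<and> isomorphic S T}"

definition age :: "('a, 'i) rel_struct \<Rightarrow> ('a, 'i) rel_struct set set" where
  "age R = {iso_class (restriction R A) | A. A \<subseteq> base R \<and> finite A}"

definition kernel_of :: "('a, 'i) rel_struct \<Rightarrow> 'a set" where
  "kernel_of R = {x \<in> base R. age (restriction R (base R - {x})) \<noteq> age R}"

text \<open>A map on the \<open>m\<close>-element subsets of the base is represented by its extension by zero to all
  sets. Maps of different degrees then live in one function space, in which nonzero maps of
  different degrees have disjoint supports, so that the span below is the direct sum of the
  spaces \<open>invariant_maps R m\<close>.\<close>

definition invariant_maps :: "('a, 'i) rel_struct \<Rightarrow> nat \<Rightarrow> ('a set \<Rightarrow> complex) set" where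
  "invariant_maps R m = {f.
     (\<forall>P. P \<notin> nsets (base R) m \<longrightarrow> f P = 0) \<and>
     (\<forall>P\<in>nsets (base R) m. \<forall>P'\<in>nsets (base R) m.
        isomorphic (restriction R P) (restriction R P') \<longrightarrow> f P = f P')}"

text \<open>The bilinear extension to the span of the product of homogeneous maps; see
  \<open>age_product_homogeneous\<close>. On infinite \<open>Q\<close> the sum is zero by convention.\<close>

definition age_product ::
    "('a set \<Rightarrow> complex) \<Rightarrow> ('a set \<Rightarrow> complex) \<Rightarrow> 'a set \<Rightarrow> complex" where
  "age_product f g = (\<lambda>Q. \<Sum>P\<in>Pow Q. f P * g (Q - P))"

definition age_algebra :: "('a, 'i) rel_struct \<Rightarrow> (complex, 'a set \<Rightarrow> complex) module" where
  "age_algebra R =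
     \<lparr>carrier = {(\<lambda>Q. \<Sum>f\<in>H. c f * f Q) | H c. finite H \<and> H \<subseteq> (\<Union>m. invariant_maps R m)},
      monoid.mult = age_product,
      one = (\<lambda>Q. if Q = {} then 1 else 0),
      zero = (\<lambda>Q. 0),
      add = (\<lambda>f g Q. f Q + g Q),
      smult = (\<lambda>c f Q. c * f Q)\<rparr>"

lemma age_product_homogeneous:
  assumes "f \<in> invariant_maps R m" "g \<in> invariant_maps R n"
  shows "Q \<in> nsets (base R) (m + n) \<Longrightarrow>
           age_product f g Q = (\<Sum>P\<in>nsets Q m. f P * g (Q - P))"
    and "Q \<notin> nsets (base R) (m + n) \<Longrightarrow> age_product f g Q = 0"
proof -
  assume "Q \<in> nsets (base R) (m + n)"
  then have "finite Q" "Q \<subseteq> base R"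
    by (auto simp: nsets_def)
  then show "age_product f g Q = (\<Sum>P\<in>nsets Q m. f P * g (Q - P))"
    unfolding age_product_def using assms(1)
    by (intro sum.mono_neutral_right) (auto simp: nsets_def invariant_maps_def)
next
  assume Q: "Q \<notin> nsets (base R) (m + n)"
  show "age_product f g Q = 0"
    unfolding age_product_def
  proof (rule sum.neutral, rule ballI)
    fix P assume P: "P \<in> Pow Q"
    have "P \<notin> nsets (base R) m \<or> Q - P \<notin> nsets (base R) n"
    proof (rule ccontr)
      assume "\<not> ?thesis"
      then have a: "P \<in> nsets (base R) m" "Q - P \<in> nsets (base R) n" by auto
      have "Q = P \<union> (Q - P)" using P by auto
      moreover have "card (P \<union> (Q - P)) = m + n"
        using a by (subst card_Un_disjoint) (auto simp: nsets_def)
      ultimately show False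
        using Q a by (auto simp: nsets_def)
    qed
    then show "f P * g (Q - P) = 0"
      using assms by (auto simp: invariant_maps_def)
  qed
qed

end

theory Submission
  imports Defs
begin

text \<open>
  Maps on finite subsets are square-free power series in variables indexed by the points, with
  \<open>x\<^sup>2 = 0\<close> for every variable. If the kernel is empty, then no finite set meets all copies of a
  given finite substructure, so the support of a nonzero invariant \<open>f\<close> has no finite transversal; call
  this robust. A robust \<open>f\<close> of bounded degree is not a zero divisor. Indeed \<open>f g = 0\<close> gives
  \<open>f\<^sup>2 \<partial>g = 0\<close>, and iterating this until \<open>g\<close> has a nonzero constant term makes \<open>f\<close> nilpotent off some
  finite set of variables. To exclude \<open>f\<^sup>N = 0\<close>, let \<open>s > 0\<close> be least such that robust derivatives
  \<open>\<partial>\<^sub>A f\<close> with \<open>card A = s\<close> exist off every finite set. Off a finite set, \<open>\<partial>\<^sub>A\<close> then acts as a derivation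
  on powers of \<open>f\<close>, so \<open>f\<^sup>k w = 0\<close> yields \<open>f\<^bsup>k-1\<^esup> (\<partial>\<^sub>A f) w\<^sup>2 = 0\<close>. After \<open>N\<close> steps a product of
  robust series of smaller degree vanishes, which is impossible by induction on the degree.

  Conversely, if every copy of a finite \<open>F\<close> contains the kernel point \<open>x\<close>, then the indicator of the
  copies of \<open>F\<close> squares to zero.
\<close>

section \<open>Square-free power series\<close>

text \<open>On an infinite set the sum defining \<open>age_product\<close> is zero by convention, so
  \<open>1\<close> is a unit only for series that vanish there. A separate type makes the generic
  laws of \<open>comm_ring_1\<close> available.\<close>

typedef 'a set_series = "{f :: 'a set \<Rightarrow> complex. \<forall>Q. infinite Q \<longrightarrow> f Q = 0}"
  morphisms coeff Abs_set_series
  by (rule exI[of _ "\<lambda>_. 0"]) simp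

lemma coeff_infinite [simp]: "infinite Q \<Longrightarrow> coeff f Q = 0"
  using coeff[of f] by simp

lemma finite_if_coeff_nonzero: "coeff f Q \<noteq> 0 \<Longrightarrow> finite Q"
  using coeff_infinite by blast

lemma coeff_Abs: "(\<And>Q. infinite Q \<Longrightarrow> f Q = 0) \<Longrightarrow> coeff (Abs_set_series f) = f"
  by (rule Abs_set_series_inverse) simp

lemma set_series_eqI: "(\<And>Q. finite Q \<Longrightarrow> coeff f Q = coeff g Q) \<Longrightarrow> f = g"
  by (metis coeff_inject coeff_infinite ext)

instantiation set_series :: (type) comm_ring_1
begin

definition "0 = Abs_set_series (\<lambda>_. 0)"
definition "1 = Abs_set_series (\<lambda>Q. if Q = {} then 1 else 0)"
definition "f + g = Abs_set_series (\<lambda>Q. coeff f Q + coeff g Q)"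
definition "- f = Abs_set_series (\<lambda>Q. - coeff f Q)"
definition "f - g = Abs_set_series (\<lambda>Q. coeff f Q - coeff g Q)"
definition "f * g = Abs_set_series (age_product (coeff f) (coeff g))"

lemma coeff_0 [simp]: "coeff 0 Q = 0"
  by (simp add: zero_set_series_def coeff_Abs)

lemma coeff_1: "coeff 1 Q = (if Q = {} then 1 else 0)"
  unfolding one_set_series_def by (subst coeff_Abs) auto

lemma coeff_add [simp]: "coeff (f + g) Q = coeff f Q + coeff g Q"
  by (simp add: plus_set_series_def coeff_Abs)

lemma coeff_minus [simp]: "coeff (- f) Q = - coeff f Q"
  by (simp add: uminus_set_series_def coeff_Abs)

lemma coeff_diff [simp]: "coeff (f - g) Q = coeff f Q - coeff g Q"
  by (simp add: minus_set_series_def coeff_Abs)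

lemma coeff_mult_eq_age_product: "coeff (f * g) = age_product (coeff f) (coeff g)"
  unfolding times_set_series_def by (rule coeff_Abs) (simp add: age_product_def)

lemma coeff_mult: "coeff (f * g) Q = (\<Sum>P\<in>Pow Q. coeff f P * coeff g (Q - P))"
  by (simp add: coeff_mult_eq_age_product age_product_def)

instance
proof
  fix f g h :: "'a set_series"
  show "f * g * h = f * (g * h)"
  proof (rule set_series_eqI)
    fix Q :: "'a set" assume Q: "finite Q"
    have "coeff (f * g * h) Q =
        (\<Sum>(P, S)\<in>Sigma (Pow Q) Pow. coeff f S * coeff g (P - S) * coeff h (Q - P))"
      using Q by (simp add: coeff_mult sum_distrib_right sum.Sigma finite_subset)
    also have "\<dots> = (\<Sum>(S, U)\<in>Sigma (Pow Q) (\<lambda>S. Pow (Q - S)).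
        coeff f S * (coeff g U * coeff h (Q - S - U)))"
      by (rule sum.reindex_bij_witness[where j = "\<lambda>(P, S). (S, P - S)" and i = "\<lambda>(S, U). (S \<union> U, S)"])
        (auto simp: mult.assoc Diff_Un intro!: arg_cong2[where f = "(*)"] arg_cong[where f = "coeff h"])
    also have "\<dots> = coeff (f * (g * h)) Q"
      using Q by (simp add: coeff_mult sum_distrib_left sum.Sigma finite_subset)
    finally show "coeff (f * g * h) Q = coeff (f * (g * h)) Q" .
  qed
  show "f * g = g * f"
  proof (rule set_series_eqI)
    fix Q :: "'a set" assume "finite Q"
    show "coeff (f * g) Q = coeff (g * f) Q"
      unfolding coeff_mult
      by (rule sum.reindex_bij_witness[where j = "\<lambda>P. Q - P" and i = "\<lambda>P. Q - P"])
        (auto simp: double_diff)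
  qed
  show "1 * f = f"
  proof (rule set_series_eqI)
    fix Q :: "'a set" assume "finite Q"
    then have "coeff (1 * f) Q = (\<Sum>P\<in>{{}}. coeff f (Q - P))"
      unfolding coeff_mult by (intro sum.mono_neutral_cong_right) (auto simp: coeff_1)
    then show "coeff (1 * f) Q = coeff f Q" by simp
  qed
  show "(f + g) * h = f * h + g * h"
    by (rule set_series_eqI) (simp add: coeff_mult sum.distrib distrib_right)
  have "coeff (0 :: 'a set_series) {} \<noteq> coeff 1 {}" by (simp add: coeff_1)
  then show "(0 :: 'a set_series) \<noteq> 1" by metis
qed (auto intro!: set_series_eqI)

end

lemma coeff_sum [simp]: "coeff (sum f A) Q = (\<Sum>x\<in>A. coeff (f x) Q)"
  by (induction A rule: infinite_finite_induct) auto

lemma coeff_of_nat_mult: "coeff (of_nat n * f) Q = of_nat n * coeff f Q"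
  by (induction n) (auto simp: algebra_simps)

text \<open>Characteristic zero enters here. It serves to cancel the exponent produced by
  differentiating a power.\<close>

lemma of_nat_mult_eq_0:
  assumes "of_nat n * f = (0 :: 'a set_series)" "n > 0"
  shows "f = 0"
proof (rule set_series_eqI)
  fix Q
  have "of_nat n * coeff f Q = 0"
    using assms(1) by (metis coeff_0 coeff_of_nat_mult)
  then show "coeff f Q = coeff 0 Q" using assms(2) by simp
qed

lemma coeff_mult_empty: "coeff (f * g) {} = coeff f {} * coeff g {}"
  by (simp add: coeff_mult)

lemma coeff_power_empty: "coeff (f ^ n) {} = coeff f {} ^ n"
  by (induction n) (auto simp: coeff_1 coeff_mult_empty)

lemma nonzero_coeffE:
  assumes "f \<noteq> 0"
  obtains A where "finite A" "coeff f A \<noteq> 0"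
proof -
  have "\<exists>A. finite A \<and> coeff f A \<noteq> coeff 0 A"
    using assms set_series_eqI[of f 0] by blast
  then show thesis using that by auto
qed

text \<open>At a set \<open>A\<close> of least size in the support of \<open>f\<close>, proper
  subsets of \<open>A\<close> contribute nothing to the product, which leaves the coefficient of
  \<open>f\<close> at \<open>A\<close> times the constant term of \<open>g\<close>.\<close>

lemma mult_eq_0_if_coeff_empty_nonzero:
  assumes "f * g = 0" "coeff g {} \<noteq> 0"
  shows "f = 0"
proof (rule ccontr)
  assume "f \<noteq> 0"
  then obtain A0 where "coeff f A0 \<noteq> 0" by (rule nonzero_coeffE)
  then obtain A where A: "coeff f A \<noteq> 0" "\<And>B. card B < card A \<Longrightarrow> coeff f B = 0"
    using exists_least_iff[of "\<lambda>n. \<exists>A. coeff f A \<noteq> 0 \<and> card A = n"] by blast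
  have "finite A" using A(1) by (rule finite_if_coeff_nonzero)
  then have "coeff (f * g) A = (\<Sum>P\<in>{A}. coeff f P * coeff g (A - P))"
    unfolding coeff_mult
    by (intro sum.mono_neutral_right) (auto simp: A(2) psubset_card_mono psubset_eq)
  then show False using A(1) assms by simp
qed

section \<open>Projections and derivatives\<close>

text \<open>Substitution of zero for all variables in \<open>T\<close>.\<close>

definition avoid :: "'a set \<Rightarrow> 'a set_series \<Rightarrow> 'a set_series" where
  "avoid T f = Abs_set_series (\<lambda>Q. if Q \<inter> T = {} then coeff f Q else 0)"

text \<open>The iterated partial derivative with respect to the variables in \<open>A\<close>; the
  result is free of these variables.\<close>

definition diff_set :: "'a set \<Rightarrow> 'a set_series \<Rightarrow> 'a set_series" where
  "diff_set A f = Abs_set_series (\<lambda>Q. if Q \<inter> A = {} then coeff f (Q \<union> A) else 0)"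

lemma coeff_avoid: "coeff (avoid T f) Q = (if Q \<inter> T = {} then coeff f Q else 0)"
  unfolding avoid_def by (subst coeff_Abs) auto

lemma coeff_diff_set: "coeff (diff_set A f) Q = (if Q \<inter> A = {} then coeff f (Q \<union> A) else 0)"
  unfolding diff_set_def by (subst coeff_Abs) auto

lemma avoid_0 [simp]: "avoid T 0 = 0"
  by (rule set_series_eqI) (simp add: coeff_avoid)

lemma avoid_1 [simp]: "avoid T 1 = 1"
  by (rule set_series_eqI) (simp add: coeff_avoid coeff_1)

text \<open>If \<open>Q\<close> is disjoint from \<open>T\<close>, so are both parts of any
  splitting of \<open>Q\<close>; if \<open>Q\<close> meets \<open>T\<close>, one part does.
  Substituting zero is therefore multiplicative.\<close>

lemma avoid_mult: "avoid T (f * g) = avoid T f * avoid T g"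
proof (rule set_series_eqI)
  fix Q :: "'a set" assume "finite Q"
  show "coeff (avoid T (f * g)) Q = coeff (avoid T f * avoid T g) Q"
  proof (cases "Q \<inter> T = {}")
    case True
    then have "P \<inter> T = {} \<and> (Q - P) \<inter> T = {}" if "P \<in> Pow Q" for P
      using that by auto
    then show ?thesis
      using True unfolding coeff_avoid[of T "f * g"] coeff_mult
      by (auto intro!: sum.cong simp: coeff_avoid)
  next
    case False
    then have "coeff (avoid T f) P * coeff (avoid T g) (Q - P) = 0" if "P \<in> Pow Q" for P
      using that by (auto simp: coeff_avoid)
    then show ?thesis
      using False unfolding coeff_mult by (simp add: coeff_avoid del: mult_eq_0_iff)
  qed
qed

lemma avoid_power: "avoid T (f ^ n) = avoid T f ^ n"
  by (induction n) (auto simp: avoid_mult)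

lemma avoid_avoid: "avoid T (avoid S f) = avoid (T \<union> S) f"
  by (rule set_series_eqI) (auto simp: coeff_avoid)

lemma avoid_empty [simp]: "avoid {} f = f"
  by (rule set_series_eqI) (simp add: coeff_avoid)

lemma avoid_mono: "avoid S f = 0 \<Longrightarrow> S \<subseteq> T \<Longrightarrow> avoid T f = 0"
  by (metis avoid_0 avoid_avoid sup.absorb1)

text \<open>For \<open>Q\<close> disjoint from \<open>T\<close> and \<open>A\<close>, the
  coefficient in question is that of \<open>f\<close> at \<open>Q \<union> A\<close>, a set disjoint
  from \<open>S\<close>. Only \<open>S\<close> has to be disjoint from \<open>A\<close>; in the
  application \<open>A\<close> lies inside \<open>T\<close>.\<close>

lemma avoid_diff_set_eq_0:
  assumes "avoid S f = 0" "S \<subseteq> T" "A \<inter> S = {}"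
  shows "avoid T (diff_set A f) = 0"
proof (rule set_series_eqI)
  fix Q
  show "coeff (avoid T (diff_set A f)) Q = coeff 0 Q"
  proof (cases "Q \<inter> T = {} \<and> Q \<inter> A = {}")
    case True
    then have "coeff f (Q \<union> A) = coeff (avoid S f) (Q \<union> A)"
      using assms(2,3) by (auto simp: coeff_avoid)
    then show ?thesis using assms(1) by (simp add: coeff_avoid coeff_diff_set)
  qed (auto simp: coeff_avoid coeff_diff_set)
qed

lemma diff_set_empty [simp]: "diff_set {} f = f"
  by (rule set_series_eqI) (simp add: coeff_diff_set)

lemma diff_set_0 [simp]: "diff_set A 0 = 0"
  by (rule set_series_eqI) (simp add: coeff_diff_set)

lemma diff_set_1: "A \<noteq> {} \<Longrightarrow> diff_set A 1 = 0"
  by (rule set_series_eqI) (auto simp: coeff_diff_set coeff_1)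

text \<open>Monomials meeting \<open>A\<close> have to be discarded, because \<open>x\<^sup>2 = 0\<close> differentiates to \<open>2x\<close>, which
  vanishes only modulo \<open>x\<close>.\<close>

lemma diff_set_mult:
  assumes A: "finite A" "A \<subseteq> T"
  shows "avoid T (diff_set A (f * g)) =
    (\<Sum>C\<in>Pow A. avoid T (diff_set C f) * avoid T (diff_set (A - C) g))"
proof (rule set_series_eqI)
  fix Q :: "'a set" assume Q: "finite Q"
  show "coeff (avoid T (diff_set A (f * g))) Q =
    coeff (\<Sum>C\<in>Pow A. avoid T (diff_set C f) * avoid T (diff_set (A - C) g)) Q"
  proof (cases "Q \<inter> T = {}")
    case True
    then have QA: "Q \<inter> A = {}" using A by auto
    have "coeff (avoid T (diff_set A (f * g))) Q =
        (\<Sum>P\<in>Pow (Q \<union> A). coeff f P * coeff g ((Q \<union> A) - P))"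
      using True QA by (simp add: coeff_avoid coeff_diff_set coeff_mult)
    \<comment> \<open>As \<open>Q\<close> and \<open>A\<close> are disjoint, a subset of their union
      is a pair of a subset of \<open>A\<close> and a subset of \<open>Q\<close>.\<close>
    also have "\<dots> = (\<Sum>(C, P)\<in>Pow A \<times> Pow Q. coeff f (P \<union> C) * coeff g ((Q - P) \<union> (A - C)))"
      by (rule sum.reindex_bij_witness[where i = "\<lambda>(C, P). P \<union> C" and j = "\<lambda>P. (P \<inter> A, P \<inter> Q)"])
        (use QA in \<open>auto intro!: arg_cong2[where f = "(*)"] arg_cong[where f = "coeff f"]
            arg_cong[where f = "coeff g"]\<close>)
    also have "\<dots> = (\<Sum>C\<in>Pow A. \<Sum>P\<in>Pow Q. coeff f (P \<union> C) * coeff g ((Q - P) \<union> (A - C)))"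
      by (simp add: sum.cartesian_product)
    also have "\<dots> = (\<Sum>C\<in>Pow A. \<Sum>P\<in>Pow Q.
        coeff (avoid T (diff_set C f)) P * coeff (avoid T (diff_set (A - C) g)) (Q - P))"
    proof (intro sum.cong refl)
      fix C P assume "C \<in> Pow A" "P \<in> Pow Q"
      then have "P \<inter> T = {}" "P \<inter> C = {}" "(Q - P) \<inter> T = {}" "(Q - P) \<inter> (A - C) = {}"
        using True QA by auto
      then show "coeff f (P \<union> C) * coeff g ((Q - P) \<union> (A - C)) =
          coeff (avoid T (diff_set C f)) P * coeff (avoid T (diff_set (A - C) g)) (Q - P)"
        by (simp add: coeff_avoid coeff_diff_set)
    qed
    finally show ?thesis by (simp add: coeff_mult)
  next
    case False
    then have "coeff (avoid T u) P * coeff (avoid T v) (Q - P) = 0" if "P \<in> Pow Q" for P u v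
      using that by (auto simp: coeff_avoid)
    then show ?thesis
      using False by (simp add: coeff_mult coeff_avoid[of _ "diff_set A (f * g)"] del: mult_eq_0_iff)
  qed
qed

section \<open>Zero divisors\<close>

text \<open>If \<open>f g = 0\<close>, then \<open>f\<^sup>2 \<partial>g = f \<partial>(f g) - \<partial>f (f g) = 0\<close>. Repeating this turns \<open>g\<close> into
  a series with nonzero constant term.\<close>

lemma nilpotent_if_mult_eq_0:
  assumes "f * g = 0" "g \<noteq> 0"
  obtains T N where "finite T" "avoid T f ^ N = 0"
proof -
  obtain A where A: "finite A" "coeff g A \<noteq> 0" using assms(2) by (rule nonzero_coeffE)
  have "\<exists>T N. finite T \<and> avoid T f ^ N = 0"
    using A assms(1)
  proof (induction A arbitrary: f g rule: finite_induct)
    case empty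
    then have "f = 0" using mult_eq_0_if_coeff_empty_nonzero by blast
    then have "avoid {} f ^ 1 = 0" by simp
    then show ?case by blast
  next
    case (insert e A)
    let ?p = "avoid {e}" and ?d = "\<lambda>u. avoid {e} (diff_set {e} u)"
    have "?d (f * g) = ?p f * ?d g + ?d f * ?p g"
      by (simp add: diff_set_mult Pow_insert)
    moreover have "?p f * ?p g = 0"
      using insert.prems(2) by (simp flip: avoid_mult)
    moreover have "?d (f * g) = 0" using insert.prems(2) by simp
    moreover have "(?p f)\<^sup>2 * ?d g = ?p f * (?p f * ?d g + ?d f * ?p g) - ?d f * (?p f * ?p g)"
      by (simp add: power2_eq_square algebra_simps)
    ultimately have "(?p f)\<^sup>2 * ?d g = 0" by simp
    \<comment> \<open>Differentiating by \<open>e\<close> shortens the chosen monomial of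
      \<open>g\<close> by one variable, so the induction hypothesis applies to the square of
      \<open>?p f\<close> and \<open>?d g\<close>.\<close>
    moreover have "coeff (?d g) A \<noteq> 0"
      using insert.hyps insert.prems(1) by (simp add: coeff_avoid coeff_diff_set)
    ultimately obtain T N where T: "finite T" "avoid T ((?p f)\<^sup>2) ^ N = 0"
      using insert.IH[of "?d g" "(?p f)\<^sup>2"] by blast
    have "avoid (T \<union> {e}) f ^ (2 * N) = 0"
      using T(2) by (simp add: avoid_power avoid_avoid power_mult)
    then show ?case using T(1) by (intro exI[of _ "T \<union> {e}"] exI[of _ "2 * N"]) simp
  qed
  then show thesis using that by blast
qed

text \<open>The support of a robust series has no finite transversal.\<close>

definition robust :: "'a set_series \<Rightarrow> bool" where
  "robust f \<longleftrightarrow> (\<forall>T. finite T \<longrightarrow> avoid T f \<noteq> 0)"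

text \<open>Being a non-zero-divisor is required after every finite substitution of zeros, because
  the nilpotency argument keeps enlarging the set of removed variables.\<close>

definition regular :: "'a set_series \<Rightarrow> bool" where
  "regular f \<longleftrightarrow> (\<forall>T. finite T \<longrightarrow> (\<forall>h. avoid T f * h = 0 \<longrightarrow> h = 0))"

lemma regular_1: "regular 1"
  by (simp add: regular_def)

lemma regularD: "regular f \<Longrightarrow> finite T \<Longrightarrow> avoid T f * h = 0 \<Longrightarrow> h = 0"
  unfolding regular_def by blast

lemma regular_mult:
  assumes "regular f" "regular g"
  shows "regular (f * g)"
  unfolding regular_def
proof (intro allI impI)
  fix T h assume T: "finite T" and "avoid T (f * g) * h = 0"
  then have "avoid T f * (avoid T g * h) = 0" by (simp only: avoid_mult mult.assoc)
  then have "avoid T g * h = 0" by (rule regularD[OF assms(1) T])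
  then show "h = 0" by (rule regularD[OF assms(2) T])
qed

lemma robust_avoid: "robust f \<Longrightarrow> finite T \<Longrightarrow> robust (avoid T f)"
  by (simp add: robust_def avoid_avoid)

lemma robust_if_coeff_empty:
  assumes "coeff f {} \<noteq> 0"
  shows "robust f"
proof -
  have "coeff (avoid T f) {} \<noteq> coeff 0 {}" for T
    using assms by (simp add: coeff_avoid)
  then show ?thesis unfolding robust_def by metis
qed

section \<open>Derivatives of powers and the exclusion of nilpotency\<close>

text \<open>In the Leibniz sum for \<open>f * f ^ n\<close> only \<open>C = {}\<close> and
  \<open>C = A\<close> survive, so the derivative along \<open>A\<close> behaves like one of first
  order. For \<open>n = 0\<close> the truncated exponent \<open>n - 1\<close> is harmless, as the
  factor \<open>of_nat n\<close> is zero.\<close>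

lemma diff_set_power:
  assumes "finite A" "A \<noteq> {}" "A \<subseteq> T"
    and vanish: "\<And>C. C \<subset> A \<Longrightarrow> C \<noteq> {} \<Longrightarrow> avoid T (diff_set C f) = 0"
  shows "avoid T (diff_set A (f ^ n)) = of_nat n * (avoid T f ^ (n - 1) * avoid T (diff_set A f))"
proof (induction n)
  case 0
  then show ?case using assms(2) by (simp add: diff_set_1)
next
  case (Suc n)
  have "avoid T (diff_set A (f ^ Suc n)) =
      (\<Sum>C\<in>Pow A. avoid T (diff_set C f) * avoid T (diff_set (A - C) (f ^ n)))"
    using assms by (simp add: diff_set_mult)
  also have "\<dots> = (\<Sum>C\<in>{{}, A}. avoid T (diff_set C f) * avoid T (diff_set (A - C) (f ^ n)))"
    using assms(1) by (intro sum.mono_neutral_right) (auto simp: vanish psubset_eq)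
  also have "\<dots> = avoid T f * (of_nat n * (avoid T f ^ (n - 1) * avoid T (diff_set A f))) +
      avoid T (diff_set A f) * avoid T f ^ n"
    using assms(2) Suc.IH by (simp add: avoid_power)
  also have "\<dots> = of_nat (Suc n) * (avoid T f ^ (Suc n - 1) * avoid T (diff_set A f))"
    by (cases n) (auto simp: algebra_simps)
  finally show ?case .
qed

text \<open>Differentiate \<open>f ^ Suc n * w = 0\<close> along \<open>A\<close> and multiply by
  \<open>w\<close>: the term containing the derivative of \<open>w\<close> drops out, since it is
  again a multiple of \<open>f ^ Suc n * w\<close>. One factor \<open>f\<close> is thereby traded
  for its derivative.\<close>

lemma power_mult_step:
  assumes A: "finite A" "A \<noteq> {}" "A \<subseteq> T" "A \<inter> S = {}" "S \<subseteq> T"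
    and vanish: "\<And>C. C \<subset> A \<Longrightarrow> C \<noteq> {} \<Longrightarrow> avoid T (diff_set C f) = 0"
    and zero: "avoid S (f ^ Suc n * w) = 0"
  shows "avoid T (f ^ n * (diff_set A f * w * w)) = 0"
proof -
  let ?p = "avoid T"
  have vanish_power: "?p (diff_set C (f ^ k)) = 0" if C: "C \<subset> A" "C \<noteq> {}" for C k
  proof -
    have "?p (diff_set C (f ^ k)) = of_nat k * (?p f ^ (k - 1) * ?p (diff_set C f))"
      using C A vanish by (intro diff_set_power) (auto intro: finite_subset)
    then show ?thesis using vanish C by simp
  qed
  have "?p (diff_set A (f ^ Suc n * w)) = 0"
    using zero A by (intro avoid_diff_set_eq_0[where S = S])
  moreover have "?p (diff_set A (f ^ Suc n * w)) =
      (\<Sum>C\<in>Pow A. ?p (diff_set C (f ^ Suc n)) * ?p (diff_set (A - C) w))"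
    by (rule diff_set_mult) fact+
  \<comment> \<open>The remaining sets \<open>C\<close> contribute nothing, whatever the derivatives
    of \<open>w\<close> are, since those of the power vanish.\<close>
  moreover have "\<dots> = (\<Sum>C\<in>{{}, A}. ?p (diff_set C (f ^ Suc n)) * ?p (diff_set (A - C) w))"
    using A(1) vanish_power[where k = "Suc n"]
    by (intro sum.mono_neutral_right) (auto simp: psubset_eq simp del: power_Suc)
  moreover have "?p (diff_set A (f ^ Suc n)) = of_nat (Suc n) * (?p f ^ n * ?p (diff_set A f))"
    using diff_set_power[of A T f "Suc n"] A vanish by simp
  ultimately have "?p (f ^ Suc n) * ?p (diff_set A w) +
      of_nat (Suc n) * (?p f ^ n * ?p (diff_set A f)) * ?p w = 0"
    using A(2) by (simp del: power_Suc of_nat_Suc)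
  moreover have "?p (f ^ Suc n) * ?p w = 0"
    using avoid_mono[OF zero A(5)] by (simp add: avoid_mult)
  moreover have "of_nat (Suc n) * (?p f ^ n * (?p (diff_set A f) * ?p w * ?p w)) =
      (?p (f ^ Suc n) * ?p (diff_set A w) +
        of_nat (Suc n) * (?p f ^ n * ?p (diff_set A f)) * ?p w) * ?p w -
      (?p (f ^ Suc n) * ?p w) * ?p (diff_set A w)"
    by (simp add: algebra_simps del: of_nat_Suc power_Suc)
  ultimately have "of_nat (Suc n) * (?p f ^ n * (?p (diff_set A f) * ?p w * ?p w)) = 0"
    by (simp only: mult_zero_left diff_self)
  then have "?p f ^ n * (?p (diff_set A f) * ?p w * ?p w) = 0"
    by (rule of_nat_mult_eq_0) simp
  then show ?thesis by (simp add: avoid_mult avoid_power)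
qed

text \<open>The derivative of \<open>f\<close> along a set of its support has a nonzero constant
  term and is thus robust. The support leaves every finite set and has sizes between 1 and
  \<open>d\<close>, so one size must occur off every finite set. The least such size is
  \<open>s\<close>, and \<open>S\<close> collects finite obstructions to all smaller ones.\<close>

lemma robust_derivative_level:
  assumes f: "robust f" "coeff f {} = 0" and deg: "\<And>A. coeff f A \<noteq> 0 \<Longrightarrow> card A \<le> d"
  obtains s S where "s > 0" "finite S"
    "\<And>T. finite T \<Longrightarrow> \<exists>A. finite A \<and> card A = s \<and> A \<inter> T = {} \<and> robust (diff_set A f)"
    "\<And>A. finite A \<Longrightarrow> A \<inter> S = {} \<Longrightarrow> A \<noteq> {} \<Longrightarrow> card A < s \<Longrightarrow> \<not> robust (diff_set A f)"
proof -
  define level where "level j T \<longleftrightarrow> (\<exists>A. finite A \<and> card A = j \<and> A \<inter> T = {} \<and> robust (diff_set A f))"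
    for j T
  have "\<exists>j. j > 0 \<and> (\<forall>T. finite T \<longrightarrow> level j T)"
  proof (rule ccontr)
    assume "\<not> ?thesis"
    then have "\<forall>j. \<exists>T. j > 0 \<longrightarrow> finite T \<and> \<not> level j T" by blast
    then obtain T where T: "\<And>j. j > 0 \<Longrightarrow> finite (T j) \<and> \<not> level j (T j)" by metis
    have "finite (\<Union>j\<in>{0<..d}. T j)" using T by auto
    then have "avoid (\<Union>j\<in>{0<..d}. T j) f \<noteq> 0" using f(1) by (auto simp: robust_def)
    then obtain A where "finite A" "coeff (avoid (\<Union>j\<in>{0<..d}. T j) f) A \<noteq> 0"
      by (rule nonzero_coeffE)
    then have A: "finite A" "A \<inter> (\<Union>j\<in>{0<..d}. T j) = {}" "coeff f A \<noteq> 0"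
      by (auto simp: coeff_avoid split: if_splits)
    have "A \<noteq> {}" using A(3) f(2) by auto
    then have card: "card A \<in> {0<..d}" using A deg by (auto simp: card_gt_0_iff)
    have "robust (diff_set A f)"
      using A by (intro robust_if_coeff_empty) (simp add: coeff_diff_set)
    moreover have "A \<inter> T (card A) = {}" using A(2) card by blast
    ultimately have "level (card A) (T (card A))"
      unfolding level_def using A(1) by blast
    then show False using T card by auto
  qed
  then obtain s where s: "s > 0" "\<And>T. finite T \<Longrightarrow> level s T"
    and min: "\<And>j. j < s \<Longrightarrow> j > 0 \<Longrightarrow> \<exists>T. finite T \<and> \<not> level j T"
    using exists_least_iff[of "\<lambda>j. j > 0 \<and> (\<forall>T. finite T \<longrightarrow> level j T)"] by metis
  from min obtain T where T: "\<And>j. j < s \<Longrightarrow> j > 0 \<Longrightarrow> finite (T j) \<and> \<not> level j (T j)" by metis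
  show thesis
  proof (rule that[of s "\<Union>j\<in>{0<..<s}. T j"])
    show "finite (\<Union>j\<in>{0<..<s}. T j)" using T by auto
    show "\<not> robust (diff_set A f)"
      if A: "finite A" "A \<inter> (\<Union>j\<in>{0<..<s}. T j) = {}" "A \<noteq> {}" "card A < s" for A
    proof
      assume "robust (diff_set A f)"
      moreover have card: "card A \<in> {0<..<s}" using A by (auto simp: card_gt_0_iff)
      then have "A \<inter> T (card A) = {}" using A(2) by blast
      ultimately have "level (card A) (T (card A))"
        unfolding level_def using A(1) by blast
      then show False using T card by auto
    qed
  qed (use s in \<open>auto simp: level_def\<close>)
qed

text \<open>A nonzero constant term survives in all powers. Otherwise the factors of
  \<open>f ^ N\<close> are replaced one by one by robust derivatives, which are regular by the
  assumption \<open>IH\<close> because their degree is smaller. This assumption is the induction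
  hypothesis of \<open>regular_if_robust\<close>.\<close>

lemma not_nilpotent_if_robust:
  fixes f :: "'a set_series"
  assumes f: "robust f" and deg: "\<And>A. coeff f A \<noteq> 0 \<Longrightarrow> card A \<le> d"
    and IH: "\<And>e (g :: 'a set_series). e < d \<Longrightarrow> robust g \<Longrightarrow> (\<And>A. coeff g A \<noteq> 0 \<Longrightarrow> card A \<le> e) \<Longrightarrow> regular g"
  shows "f ^ N \<noteq> 0"
proof (cases "coeff f {} = 0")
  case False
  then have "coeff (f ^ N) {} \<noteq> coeff 0 {}" by (simp add: coeff_power_empty)
  then show ?thesis by metis
next
  case True
  obtain s S where s: "s > 0" "finite S"
    and level: "\<And>T. finite T \<Longrightarrow> \<exists>A. finite A \<and> card A = s \<and> A \<inter> T = {} \<and> robust (diff_set A f)"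
    and below: "\<And>A. finite A \<Longrightarrow> A \<inter> S = {} \<Longrightarrow> A \<noteq> {} \<Longrightarrow> card A < s \<Longrightarrow> \<not> robust (diff_set A f)"
    using robust_derivative_level[OF f True deg] by blast
  show ?thesis
  proof
    assume nil: "f ^ N = 0"
    \<comment> \<open>The cofactor \<open>w\<close> collects the derivatives used so far. Keeping
      \<open>S \<subseteq> T\<close> ensures that the next \<open>A\<close>, chosen off
      \<open>T\<close>, also avoids \<open>S\<close>, so that \<open>below\<close> applies to its
      subsets. At \<open>k = N\<close> only \<open>w\<close> is left.\<close>
    have "\<exists>T w. finite T \<and> S \<subseteq> T \<and> regular w \<and> avoid T (f ^ (N - k) * w) = 0" if "k \<le> N" for k
      using that
    proof (induction k)
      case 0
      then show ?case using s nil regular_1 by (intro exI[of _ S] exI[of _ 1]) simp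
    next
      case (Suc k)
      then obtain T w where T: "finite T" "S \<subseteq> T" "regular w" "avoid T (f ^ (N - k) * w) = 0"
        by auto
      obtain A where A: "finite A" "card A = s" "A \<inter> T = {}" "robust (diff_set A f)"
        using level T(1) by blast
      have "A \<noteq> {}" using A s by auto
      have "\<exists>U. finite U \<and> avoid U (diff_set C f) = 0" if "C \<subset> A" "C \<noteq> {}" for C
      proof -
        have "\<not> robust (diff_set C f)"
          using that A T by (intro below) (auto intro: finite_subset psubset_card_mono)
        then show ?thesis by (auto simp: robust_def)
      qed
      then obtain U where U: "\<And>C. C \<subset> A \<Longrightarrow> C \<noteq> {} \<Longrightarrow> finite (U C) \<and> avoid (U C) (diff_set C f) = 0"
        by metis
      \<comment> \<open>The variables in \<open>A\<close> are removed for the Leibniz rule, and each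
        \<open>U C\<close> to annihilate the derivative along a nonempty proper subset
        \<open>C\<close> of \<open>A\<close>.\<close>
      define T' where "T' = T \<union> A \<union> (\<Union>C\<in>Pow A - {{}, A}. U C)"
      have "finite T'" using T A U by (auto simp: T'_def)
      have "regular (diff_set A f)"
      proof (rule IH)
        \<comment> \<open>A set in the support of the derivative shows \<open>s \<le> d\<close>;
          with \<open>s > 0\<close> this makes \<open>d - s\<close> a proper decrease.\<close>
        have "diff_set A f \<noteq> 0" using A(4) unfolding robust_def by (metis avoid_0 finite.emptyI)
        then obtain Q where "finite Q" "coeff (diff_set A f) Q \<noteq> 0" by (rule nonzero_coeffE)
        then have "card (Q \<union> A) \<le> d" by (auto simp: coeff_diff_set deg split: if_splits)
        moreover have "card A \<le> card (Q \<union> A)"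
          using \<open>finite Q\<close> A(1) by (intro card_mono) auto
        ultimately show "d - s < d" using A s by linarith
        show "card Q \<le> d - s" if "coeff (diff_set A f) Q \<noteq> 0" for Q
        proof -
          have "finite Q" "Q \<inter> A = {}" "card (Q \<union> A) \<le> d"
            using that finite_if_coeff_nonzero[OF that]
            by (auto simp: coeff_diff_set deg split: if_splits)
          then show ?thesis using A by (simp add: card_Un_disjoint)
        qed
      qed fact
      then have "regular (diff_set A f * w * w)" using T(3) by (intro regular_mult)
      moreover have "avoid T' (f ^ (N - Suc k) * (diff_set A f * w * w)) = 0"
      proof (rule power_mult_step)
        show "avoid T (f ^ Suc (N - Suc k) * w) = 0" using T(4) Suc.prems by (simp add: Suc_diff_Suc)
        show "avoid T' (diff_set C f) = 0" if "C \<subset> A" "C \<noteq> {}" for C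
          using U[OF that] that by (auto simp: T'_def intro: avoid_mono)
      qed (use A \<open>A \<noteq> {}\<close> in \<open>auto simp: T'_def\<close>)
      moreover have "S \<subseteq> T'" using T(2) by (auto simp: T'_def)
      ultimately show ?case using \<open>finite T'\<close> by blast
    qed
    from this[OF order_refl] obtain T and w :: "'a set_series"
      where "finite T" "regular w" "avoid T w * 1 = 0"
      by auto
    then show False unfolding regular_def by (metis one_neq_zero)
  qed
qed

text \<open>A zero divisor would be nilpotent off a finite set by
  \<open>nilpotent_if_mult_eq_0\<close>. Removing finitely many variables preserves both robustness
  and the degree bound, so \<open>not_nilpotent_if_robust\<close> gives a contradiction.\<close>

lemma regular_if_robust:
  assumes "robust f" "\<And>A. coeff f A \<noteq> 0 \<Longrightarrow> card A \<le> d"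
  shows "regular f"
  using assms
proof (induction d arbitrary: f rule: less_induct)
  case (less d)
  show ?case unfolding regular_def
  proof (intro allI impI, rule ccontr)
    fix T h assume T: "finite T" and h: "avoid T f * h = 0" "h \<noteq> 0"
    obtain S N where S: "finite S" "avoid S (avoid T f) ^ N = 0"
      using nilpotent_if_mult_eq_0[OF h] by blast
    have "avoid S (avoid T f) ^ N \<noteq> 0"
    proof (rule not_nilpotent_if_robust)
      show "robust (avoid S (avoid T f))" using less.prems(1) S(1) T by (intro robust_avoid)
      show "card A \<le> d" if "coeff (avoid S (avoid T f)) A \<noteq> 0" for A
        using that less.prems(2)[of A] by (auto simp: coeff_avoid split: if_splits)
    qed (rule less.IH)
    then show False using S(2) by simp
  qed
qed

section \<open>Copies of finite substructures\<close>

lemma restriction_restriction: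
  "A \<subseteq> B \<Longrightarrow> restriction (restriction R B) A = restriction R A"
  unfolding restriction_def tuples_def by (cases R) (auto intro!: ext)

lemma base_restriction [simp]: "base (restriction R A) = A"
  by (simp add: restriction_def)

lemma relational_structure_restriction: "relational_structure (restriction R A)"
  by (simp add: relational_structure_def restriction_def)

lemma isomorphic_refl: "isomorphic S S"
  unfolding isomorphic_def same_signature_def by (auto intro!: exI[of _ id])

lemma isomorphic_sym:
  assumes "isomorphic S T"
  shows "isomorphic T S"
proof -
  obtain h where h: "bij_betw h (base S) (base T)" and sig: "same_signature S T"
    and rels: "\<And>i xs. i \<in> indices S \<Longrightarrow> xs \<in> tuples (base S) (arity S i) \<Longrightarrow>
      xs \<in> rels S i \<longleftrightarrow> map h xs \<in> rels T i"
    using assms unfolding isomorphic_def by blast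
  let ?k = "inv_into (base S) h"
  have "xs \<in> rels T i \<longleftrightarrow> map ?k xs \<in> rels S i"
    if i: "i \<in> indices T" and xs: "xs \<in> tuples (base T) (arity T i)" for i xs
  proof -
    have "?k ` base T = base S"
      using bij_betw_inv_into[OF h] by (simp add: bij_betw_def)
    then have "map ?k xs \<in> tuples (base S) (arity S i)"
      using xs i sig by (auto simp: tuples_def same_signature_def)
    moreover have "map h (map ?k xs) = xs"
      using xs h by (auto simp: tuples_def bij_betw_def f_inv_into_f intro!: map_idI)
    ultimately show ?thesis
      using i sig rels by (metis same_signature_def)
  qed
  then show ?thesis
    using sig bij_betw_inv_into[OF h] unfolding isomorphic_def same_signature_def by auto
qed

lemma isomorphic_trans:
  assumes "isomorphic S T" "isomorphic T U"
  shows "isomorphic S U"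
proof -
  obtain h where h: "bij_betw h (base S) (base T)" and sig_ST: "same_signature S T"
    and rels_ST: "\<And>i xs. i \<in> indices S \<Longrightarrow> xs \<in> tuples (base S) (arity S i) \<Longrightarrow>
      xs \<in> rels S i \<longleftrightarrow> map h xs \<in> rels T i"
    using assms(1) unfolding isomorphic_def by blast
  obtain k where k: "bij_betw k (base T) (base U)" and sig_TU: "same_signature T U"
    and rels_TU: "\<And>i xs. i \<in> indices T \<Longrightarrow> xs \<in> tuples (base T) (arity T i) \<Longrightarrow>
      xs \<in> rels T i \<longleftrightarrow> map k xs \<in> rels U i"
    using assms(2) unfolding isomorphic_def by blast
  have "xs \<in> rels S i \<longleftrightarrow> map (k \<circ> h) xs \<in> rels U i"
    if i: "i \<in> indices S" and xs: "xs \<in> tuples (base S) (arity S i)" for i xs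
  proof -
    have "map h xs \<in> tuples (base T) (arity T i)"
      using xs h i sig_ST by (auto simp: tuples_def bij_betw_def same_signature_def)
    then show ?thesis
      using rels_ST[OF i xs] rels_TU[of i "map h xs"] i sig_ST by (simp add: same_signature_def)
  qed
  then show ?thesis
    using sig_ST sig_TU bij_betw_trans[OF h k] unfolding isomorphic_def same_signature_def by auto
qed

abbreviation copy_of :: "('a, 'i) rel_struct \<Rightarrow> 'a set \<Rightarrow> 'a set \<Rightarrow> bool" where
  "copy_of R A B \<equiv> isomorphic (restriction R A) (restriction R B)"

text \<open>A single bijection serves all subsets of \<open>A\<close> at once, so a whole
  configuration of substructures can be moved together.\<close>

lemma copy_ofE:
  assumes "copy_of R A B"
  obtains h where "bij_betw h A B" "\<forall>P. P \<subseteq> A \<longrightarrow> copy_of R P (h ` P)"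
proof -
  obtain h where h: "bij_betw h A B"
    and rels: "\<And>i xs. i \<in> indices R \<Longrightarrow> xs \<in> tuples A (arity R i) \<Longrightarrow>
      xs \<in> tuples A (arity R i) \<inter> rels R i \<longleftrightarrow> map h xs \<in> tuples B (arity R i) \<inter> rels R i"
    using assms unfolding isomorphic_def restriction_def by auto
  have "copy_of R P (h ` P)" if P: "P \<subseteq> A" for P
  proof -
    have "bij_betw h P (h ` P)" using h P by (auto intro: bij_betw_subset)
    moreover have "xs \<in> tuples P (arity R i) \<inter> rels R i \<longleftrightarrow>
        map h xs \<in> tuples (h ` P) (arity R i) \<inter> rels R i"
      if i: "i \<in> indices R" and xs: "xs \<in> tuples P (arity R i)" for i xs
      using rels[OF i, of xs] xs P h by (auto simp: tuples_def bij_betw_def)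
    ultimately show ?thesis
      unfolding isomorphic_def same_signature_def restriction_def by auto
  qed
  then show thesis using h that by blast
qed

lemma copy_of_card: "copy_of R A B \<Longrightarrow> card A = card B"
  by (metis bij_betw_same_card copy_ofE)

lemma copy_of_finite: "copy_of R A B \<Longrightarrow> finite A \<longleftrightarrow> finite B"
  by (metis bij_betw_finite copy_ofE)

lemma iso_class_restriction_eq_iff:
  "iso_class (restriction R A) = iso_class (restriction R B) \<longleftrightarrow> copy_of R A B"
proof
  assume "iso_class (restriction R A) = iso_class (restriction R B)"
  moreover have "restriction R B \<in> iso_class (restriction R B)"
    by (simp add: iso_class_def relational_structure_restriction isomorphic_refl)
  ultimately show "copy_of R A B" by (auto simp: iso_class_def)
next
  assume AB: "copy_of R A B"
  show "iso_class (restriction R A) = iso_class (restriction R B)"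
    using isomorphic_trans[OF AB] isomorphic_trans[OF isomorphic_sym[OF AB]]
    unfolding iso_class_def by (intro Collect_cong) blast
qed

lemma age_restriction:
  "age (restriction R B) = {iso_class (restriction R A) | A. A \<subseteq> B \<and> finite A}"
proof -
  have "(u = iso_class (restriction (restriction R B) A) \<and> A \<subseteq> B \<and> finite A) \<longleftrightarrow>
      (u = iso_class (restriction R A) \<and> A \<subseteq> B \<and> finite A)" for u A
    by (cases "A \<subseteq> B") (simp_all add: restriction_restriction)
  then show ?thesis by (simp only: age_def base_restriction)
qed

text \<open>Deleting a point can only shrink the age, so the two ages differ exactly when some
  finite type is lost, that is, when all its copies pass through \<open>x\<close>.\<close>

lemma mem_kernel_iff:
  "x \<in> kernel_of R \<longleftrightarrow> x \<in> base R \<and>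
    (\<exists>A. A \<subseteq> base R \<and> finite A \<and> (\<forall>B. B \<subseteq> base R \<longrightarrow> copy_of R A B \<longrightarrow> x \<in> B))"
proof -
  let ?S = "restriction R (base R - {x})"
  have "age ?S \<subseteq> age R" unfolding age_restriction by (auto simp: age_def)
  then have "age ?S \<noteq> age R \<longleftrightarrow>
      (\<exists>A. A \<subseteq> base R \<and> finite A \<and> iso_class (restriction R A) \<notin> age ?S)"
    by (auto simp: age_def[of R])
  moreover have "iso_class (restriction R A) \<notin> age ?S \<longleftrightarrow>
      (\<forall>B. B \<subseteq> base R \<longrightarrow> copy_of R A B \<longrightarrow> x \<in> B)" if "finite A" for A
  proof -
    have "iso_class (restriction R A) \<in> age ?S \<longleftrightarrow>
        (\<exists>B. B \<subseteq> base R - {x} \<and> finite B \<and> copy_of R A B)"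
      unfolding age_restriction mem_Collect_eq iso_class_restriction_eq_iff by blast
    moreover have "finite B" if "copy_of R A B" for B
      using copy_of_finite[OF that] \<open>finite A\<close> by simp
    ultimately show ?thesis by blast
  qed
  ultimately show ?thesis by (auto simp: kernel_of_def)
qed

section \<open>Finite transversals of families of copies\<close>

text \<open>A compactness argument by induction on \<open>j\<close>. A transversal must contain a
  point \<open>x\<close> of a fixed member \<open>F\<close>, and its other points must meet all
  members without \<open>x\<close>. Finite subfamilies for the finitely many
  \<open>x \<in> F\<close>, together with \<open>F\<close>, suffice.\<close>

lemma finite_subfamily_without_small_transversal:
  assumes "\<And>F. F \<in> \<F> \<Longrightarrow> finite F"
    and "\<And>T. finite T \<Longrightarrow> card T \<le> j \<Longrightarrow> \<exists>F\<in>\<F>. F \<inter> T = {}"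
  shows "\<exists>\<S>. finite \<S> \<and> \<S> \<subseteq> \<F> \<and>
    (\<forall>T. finite T \<longrightarrow> card T \<le> j \<longrightarrow> (\<exists>F\<in>\<S>. F \<inter> T = {}))"
  using assms
proof (induction j arbitrary: \<F>)
  case 0
  have "\<exists>F\<in>\<F>. F \<inter> {} = {}" by (rule "0.prems") auto
  then obtain F where "F \<in> \<F>" by blast
  then show ?case by (intro exI[of _ "{F}"]) auto
next
  case (Suc j)
  have "\<exists>F\<in>\<F>. F \<inter> {} = {}" by (rule Suc.prems) auto
  then obtain F where F: "F \<in> \<F>" by blast
  have "\<exists>\<S>. finite \<S> \<and> \<S> \<subseteq> {G \<in> \<F>. x \<notin> G} \<and>
      (\<forall>T. finite T \<longrightarrow> card T \<le> j \<longrightarrow> (\<exists>G\<in>\<S>. G \<inter> T = {}))" for x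
  proof (rule Suc.IH)
    fix T :: "'a set" assume "finite T" "card T \<le> j"
    \<comment> \<open>Adding \<open>x\<close> to a transversal of the members without
      \<open>x\<close> would give a transversal of the whole family.\<close>
    then have "\<exists>G\<in>\<F>. G \<inter> insert x T = {}"
      by (intro Suc.prems(2)) (auto simp: card_insert_if)
    then show "\<exists>G\<in>{G \<in> \<F>. x \<notin> G}. G \<inter> T = {}" by auto
  qed (use Suc.prems(1) in auto)
  then obtain \<S> where \<S>: "\<And>x. finite (\<S> x)" "\<And>x. \<S> x \<subseteq> {G \<in> \<F>. x \<notin> G}"
    "\<And>x T. finite T \<Longrightarrow> card T \<le> j \<Longrightarrow> \<exists>G\<in>\<S> x. G \<inter> T = {}"
    by metis
  show ?case
  proof (intro exI[of _ "insert F (\<Union>x\<in>F. \<S> x)"] conjI allI impI)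
    show "finite (insert F (\<Union>x\<in>F. \<S> x))" using \<S>(1) Suc.prems(1) F by auto
    show "insert F (\<Union>x\<in>F. \<S> x) \<subseteq> \<F>" using \<S>(2) F by auto
    fix T :: "'a set" assume T: "finite T" "card T \<le> Suc j"
    show "\<exists>G\<in>insert F (\<Union>x\<in>F. \<S> x). G \<inter> T = {}"
    proof (cases "F \<inter> T = {}")
      case False
      then obtain x where x: "x \<in> F" "x \<in> T" by blast
      then have "card (T - {x}) \<le> j" using T by simp
      then obtain G where "G \<in> \<S> x" "G \<inter> (T - {x}) = {}" using \<S>(3) T(1) by blast
      moreover have "x \<notin> G" using \<open>G \<in> \<S> x\<close> \<S>(2)[of x] by blast
      ultimately show ?thesis using x(1) by blast
    qed auto
  qed
qed

text \<open>An empty kernel allows one point at a time to be avoided. Let \<open>U\<close> be a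
  smallest finite transversal of the copies of \<open>F\<close> and \<open>t \<in> U\<close>.
  Finitely many copies already have no transversal with fewer than \<open>card U\<close> points.
  Moving their union off \<open>t\<close> yields copies that all meet \<open>U - {t}\<close>, and
  pulling this set back gives a forbidden transversal.\<close>

lemma copy_avoiding_finite_set:
  assumes "kernel_of R = {}" "F \<subseteq> base R" "finite F" "finite T"
  obtains F' where "F' \<subseteq> base R" "copy_of R F F'" "F' \<inter> T = {}"
proof (rule ccontr)
  assume "\<not> thesis"
  define \<F> where "\<F> = {F'. F' \<subseteq> base R \<and> copy_of R F F'}"
  define transversal where "transversal U \<longleftrightarrow> finite U \<and> (\<forall>F'\<in>\<F>. F' \<inter> U \<noteq> {})" for U
  have "transversal T"
    using \<open>\<not> thesis\<close> that assms(4) unfolding transversal_def \<F>_def by blast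
  then obtain U where U: "transversal U" and min: "\<And>V. card V < card U \<Longrightarrow> \<not> transversal V"
    using exists_least_iff[of "\<lambda>n. \<exists>U. transversal U \<and> card U = n"] by blast
  have "F \<in> \<F>" using assms(2) isomorphic_refl by (auto simp: \<F>_def)
  then obtain t where t: "t \<in> U" "t \<in> F" using U unfolding transversal_def by blast
  have U_fin: "finite U" using U by (simp add: transversal_def)
  have card_U: "card (U - {t}) = card U - 1" "card U > 0"
    using t(1) U_fin by (auto simp: card_gt_0_iff)
  have fin: "finite F'" if "F' \<in> \<F>" for F'
    using that assms(3) copy_of_finite unfolding \<F>_def by blast
  have small: "\<exists>F'\<in>\<F>. F' \<inter> V = {}" if "finite V" "card V \<le> card U - 1" for V
    using min[of V] that card_U(2) unfolding transversal_def by fastforce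
  have "\<exists>\<S>. finite \<S> \<and> \<S> \<subseteq> \<F> \<and>
      (\<forall>V. finite V \<longrightarrow> card V \<le> card U - 1 \<longrightarrow> (\<exists>G\<in>\<S>. G \<inter> V = {}))"
    by (rule finite_subfamily_without_small_transversal[OF fin small])
  then obtain \<S> where \<S>: "finite \<S>" "\<S> \<subseteq> \<F>"
    "\<forall>V. finite V \<longrightarrow> card V \<le> card U - 1 \<longrightarrow> (\<exists>G\<in>\<S>. G \<inter> V = {})"
    by (elim exE conjE)
  have "\<Union>\<S> \<subseteq> base R" using \<S>(2) by (auto simp: \<F>_def)
  moreover have "finite (\<Union>\<S>)" using \<S>(1,2) fin by (intro finite_Union) auto
  moreover have "t \<in> base R" "t \<notin> kernel_of R" using t(2) assms(1,2) by auto
  \<comment> \<open>The kernel hypothesis is applied to the finite union of the subfamily, not to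
    \<open>F\<close> itself.\<close>
  ultimately obtain W where W: "W \<subseteq> base R" "copy_of R (\<Union>\<S>) W" "t \<notin> W"
    unfolding mem_kernel_iff by blast
  from W(2) obtain h where bij: "bij_betw h (\<Union>\<S>) W"
    and copies: "\<forall>P. P \<subseteq> \<Union>\<S> \<longrightarrow> copy_of R P (h ` P)"
    by (rule copy_ofE)
  \<comment> \<open>The preimage under \<open>h\<close> of the part of \<open>U\<close> that can
    meet \<open>W\<close>; it has at most \<open>card U - 1\<close> points, so some member of the
    subfamily misses it.\<close>
  let ?V = "inv_into (\<Union>\<S>) h ` ((U - {t}) \<inter> W)"
  have "card ?V \<le> card ((U - {t}) \<inter> W)" using U_fin by (intro card_image_le) auto
  also have "\<dots> \<le> card U - 1"
    using U_fin card_U(1) by (metis Int_lower1 card_mono finite_Diff)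
  finally have "\<exists>G\<in>\<S>. G \<inter> ?V = {}" using \<S>(3) U_fin by simp
  then obtain G where G: "G \<in> \<S>" "G \<inter> ?V = {}" by blast
  have "copy_of R G (h ` G)"
    using copies G(1) by blast
  moreover have "h ` G \<subseteq> W" using G(1) bij by (auto simp: bij_betw_def)
  ultimately have "h ` G \<in> \<F>"
    using G(1) \<S>(2) W(1) unfolding \<F>_def by (auto intro: isomorphic_trans)
  then obtain y where y: "y \<in> G" "h y \<in> U" using U unfolding transversal_def by blast
  have "h y \<in> (U - {t}) \<inter> W" using y \<open>h ` G \<subseteq> W\<close> W(3) by auto
  moreover have "inv_into (\<Union>\<S>) h (h y) = y"
    using bij y(1) G(1) by (intro inv_into_f_f) (auto simp: bij_betw_def)
  ultimately have "y \<in> ?V" by (metis imageI)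
  then show False using y(1) G(2) by auto
qed

section \<open>The age algebra\<close>

text \<open>The carrier of the age algebra without linear combinations: finiteness of a sum of
  homogeneous maps becomes the bound \<open>d\<close>. One invariance condition covers all degrees,
  because copies have equal size.\<close>

definition age_maps :: "('a, 'i) rel_struct \<Rightarrow> ('a set \<Rightarrow> complex) set" where
  "age_maps R = {f.
     (\<exists>d. \<forall>Q. f Q \<noteq> 0 \<longrightarrow> Q \<subseteq> base R \<and> finite Q \<and> card Q \<le> d) \<and>
     (\<forall>P Q. P \<subseteq> base R \<longrightarrow> Q \<subseteq> base R \<longrightarrow> finite P \<longrightarrow> copy_of R P Q \<longrightarrow> f P = f Q)}"

lemma age_mapsI:
  assumes "\<And>Q. f Q \<noteq> 0 \<Longrightarrow> Q \<subseteq> base R \<and> finite Q \<and> card Q \<le> d"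
    and "\<And>P Q. P \<subseteq> base R \<Longrightarrow> Q \<subseteq> base R \<Longrightarrow> finite P \<Longrightarrow> copy_of R P Q \<Longrightarrow> f P = f Q"
  shows "f \<in> age_maps R"
  unfolding age_maps_def mem_Collect_eq
  by (intro conjI exI[of _ d] allI impI assms)

lemma age_maps_boundE:
  assumes "f \<in> age_maps R"
  obtains d where "\<forall>Q. f Q \<noteq> 0 \<longrightarrow> Q \<subseteq> base R \<and> finite Q \<and> card Q \<le> d"
  using assms unfolding age_maps_def mem_Collect_eq by (elim conjE exE)

lemma age_maps_copy_of:
  assumes "f \<in> age_maps R" "copy_of R P Q" "P \<subseteq> base R" "Q \<subseteq> base R" "finite P"
  shows "f P = f Q"
  using assms unfolding age_maps_def by simp

lemma invariant_maps_sum_mem_age_maps: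
  assumes "finite H" "H \<subseteq> (\<Union>m. invariant_maps R m)"
  shows "(\<lambda>Q. \<Sum>f\<in>H. c f * f Q) \<in> age_maps R"
proof -
  obtain m where m: "\<And>f. f \<in> H \<Longrightarrow> f \<in> invariant_maps R (m f)"
    using assms(2) by (metis UN_E subsetD)
  have "\<exists>d. \<forall>Q. (\<Sum>f\<in>H. c f * f Q) \<noteq> 0 \<longrightarrow> Q \<subseteq> base R \<and> finite Q \<and> card Q \<le> d"
  proof (intro exI[of _ "Max (m ` H)"] allI impI)
    fix Q assume "(\<Sum>f\<in>H. c f * f Q) \<noteq> 0"
    then obtain f where "f \<in> H" "f Q \<noteq> 0"
      by (elim sum.not_neutral_contains_not_neutral) auto
    then have "Q \<in> nsets (base R) (m f)" using m unfolding invariant_maps_def by blast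
    then show "Q \<subseteq> base R \<and> finite Q \<and> card Q \<le> Max (m ` H)"
      using \<open>f \<in> H\<close> assms(1) by (auto simp: nsets_def)
  qed
  moreover have "f P = f Q"
    if "f \<in> H" "P \<subseteq> base R" "Q \<subseteq> base R" "finite P" "copy_of R P Q" for f P Q
  proof -
    have "finite Q" "card P = card Q"
      using that copy_of_finite copy_of_card by blast+
    then have "P \<in> nsets (base R) (m f) \<longleftrightarrow> Q \<in> nsets (base R) (m f)"
      using that by (auto simp: nsets_def)
    then show ?thesis
      using m[OF that(1)] that(5) unfolding invariant_maps_def by (cases "P \<in> nsets (base R) (m f)") auto
  qed
  ultimately show ?thesis by (auto simp: age_maps_def intro!: sum.cong)
qed

lemma carrier_age_algebra: "carrier (age_algebra R) = age_maps R"
proof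
  show "carrier (age_algebra R) \<subseteq> age_maps R"
    using invariant_maps_sum_mem_age_maps by (auto simp: age_algebra_def)
  show "age_maps R \<subseteq> carrier (age_algebra R)"
  proof
    fix f assume f: "f \<in> age_maps R"
    then obtain d where d: "\<forall>Q. f Q \<noteq> 0 \<longrightarrow> Q \<subseteq> base R \<and> finite Q \<and> card Q \<le> d"
      by (rule age_maps_boundE)
    define hom where "hom m = (\<lambda>Q. if Q \<in> nsets (base R) m then f Q else 0)" for m
    have hom: "hom m \<in> invariant_maps R m" for m
      using f by (auto simp: hom_def invariant_maps_def age_maps_def nsets_def)
    \<comment> \<open>The sum runs over the set of components, where equal ones are counted once.
      Nothing is lost: at \<open>Q\<close> only the component of degree \<open>card Q\<close> can be
      nonzero.\<close>
    have "f Q = (\<Sum>h\<in>hom ` {..d}. 1 * h Q)" for Q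
    proof (cases "f Q = 0")
      case True
      then have "(\<Sum>h\<in>hom ` {..d}. 1 * h Q) = 0"
        by (intro sum.neutral) (auto simp: hom_def)
      then show ?thesis using True by simp
    next
      case False
      then have Q: "hom (card Q) \<in> hom ` {..d}" "hom (card Q) Q = f Q"
        using d by (auto simp: hom_def nsets_def)
      have "h Q = 0" if "h \<in> hom ` {..d}" "h \<noteq> hom (card Q)" for h
        using that by (auto simp: hom_def nsets_def)
      then have "(\<Sum>h\<in>hom ` {..d}. 1 * h Q) = (\<Sum>h\<in>{hom (card Q)}. 1 * h Q)"
        using Q(1) by (intro sum.mono_neutral_right) auto
      then show ?thesis using Q(2) by simp
    qed
    then have "f = (\<lambda>Q. \<Sum>h\<in>hom ` {..d}. 1 * h Q)" by (rule ext)
    moreover have "finite (hom ` {..d})" "hom ` {..d} \<subseteq> (\<Union>m. invariant_maps R m)"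
      using hom by auto
    ultimately have "\<exists>H c. f = (\<lambda>Q. \<Sum>h\<in>H. c h * h Q) \<and> finite H \<and> H \<subseteq> (\<Union>m. invariant_maps R m)"
      by (intro exI[of _ "hom ` {..d}"] exI[of _ "\<lambda>_. 1"] conjI)
    then show "f \<in> carrier (age_algebra R)" by (simp add: age_algebra_def)
  qed
qed

lemma age_maps_infinite: "f \<in> age_maps R \<Longrightarrow> infinite Q \<Longrightarrow> f Q = 0"
  by (auto simp: age_maps_def)

lemma coeff_Abs_age_map [simp]: "f \<in> age_maps R \<Longrightarrow> coeff (Abs_set_series f) = f"
  by (rule coeff_Abs) (rule age_maps_infinite)

lemma age_maps_coeffE:
  assumes "f \<in> age_maps R"
  obtains u where "f = coeff u"
  using coeff_Abs_age_map[OF assms] by metis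

lemma age_maps_zero: "coeff 0 \<in> age_maps R"
  by (simp add: age_maps_def)

lemma age_maps_one: "coeff 1 \<in> age_maps R"
proof (rule age_mapsI)
  show "coeff 1 P = coeff 1 Q" if "finite P" "copy_of R P Q" for P Q
    using that copy_of_card[OF that(2)] copy_of_finite[OF that(2)]
    by (auto simp: coeff_1)
qed (auto simp: coeff_1 split: if_splits)

lemma age_maps_uminus: "f \<in> age_maps R \<Longrightarrow> (\<lambda>Q. - f Q) \<in> age_maps R"
  by (simp add: age_maps_def)

lemma age_maps_add:
  assumes "f \<in> age_maps R" "g \<in> age_maps R"
  shows "(\<lambda>Q. f Q + g Q) \<in> age_maps R"
proof -
  obtain d where d: "\<forall>Q. f Q \<noteq> 0 \<longrightarrow> Q \<subseteq> base R \<and> finite Q \<and> card Q \<le> d"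
    using assms(1) by (rule age_maps_boundE)
  obtain e where e: "\<forall>Q. g Q \<noteq> 0 \<longrightarrow> Q \<subseteq> base R \<and> finite Q \<and> card Q \<le> e"
    using assms(2) by (rule age_maps_boundE)
  show ?thesis
  proof (rule age_mapsI)
    fix Q assume "f Q + g Q \<noteq> 0"
    then have "f Q \<noteq> 0 \<or> g Q \<noteq> 0" by auto
    then show "Q \<subseteq> base R \<and> finite Q \<and> card Q \<le> max d e"
      using d[rule_format, of Q] e[rule_format, of Q] by (auto simp: le_max_iff_disj)
  next
    fix P Q assume "P \<subseteq> base R" "Q \<subseteq> base R" "finite P" "copy_of R P Q"
    then show "f P + g P = f Q + g Q"
      using assms[THEN age_maps_copy_of] by metis
  qed
qed

text \<open>Degree bounds add up. An isomorphism from \<open>A\<close> to \<open>B\<close> restricts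
  to every subset of \<open>A\<close> and its complement, and so matches the two sums term by
  term.\<close>

lemma age_maps_mult:
  assumes "f \<in> age_maps R" "g \<in> age_maps R"
  shows "age_product f g \<in> age_maps R"
proof -
  obtain d where d: "\<forall>Q. f Q \<noteq> 0 \<longrightarrow> Q \<subseteq> base R \<and> finite Q \<and> card Q \<le> d"
    using assms(1) by (rule age_maps_boundE)
  obtain e where e: "\<forall>Q. g Q \<noteq> 0 \<longrightarrow> Q \<subseteq> base R \<and> finite Q \<and> card Q \<le> e"
    using assms(2) by (rule age_maps_boundE)
  show ?thesis
  proof (rule age_mapsI)
    fix Q assume "age_product f g Q \<noteq> 0"
    then obtain P where P: "P \<subseteq> Q" "f P \<noteq> 0" "g (Q - P) \<noteq> 0"
      unfolding age_product_def by (elim sum.not_neutral_contains_not_neutral) auto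
    have "P \<subseteq> base R" "finite P" "card P \<le> d" using d P(2) by auto
    moreover have "Q - P \<subseteq> base R" "finite (Q - P)" "card (Q - P) \<le> e" using e P(3) by auto
    moreover have "Q = P \<union> (Q - P)" using P(1) by auto
    moreover have "card (P \<union> (Q - P)) \<le> card P + card (Q - P)" by (rule card_Un_le)
    ultimately show "Q \<subseteq> base R \<and> finite Q \<and> card Q \<le> d + e"
      by (metis Un_least add_mono finite_UnI order_trans)
  next
    fix A B assume AB: "A \<subseteq> base R" "B \<subseteq> base R" "finite A" "copy_of R A B"
    obtain h where h: "bij_betw h A B" and copies: "\<forall>P. P \<subseteq> A \<longrightarrow> copy_of R P (h ` P)"
      using AB(4) by (rule copy_ofE)
    have "f P * g (A - P) = f (h ` P) * g (B - h ` P)" if P: "P \<subseteq> A" for P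
    proof -
      have "B - h ` P = h ` (A - P)"
        using h P by (metis Diff_subset bij_betw_def inj_on_image_set_diff)
      moreover have image: "h ` S \<subseteq> base R" if "S \<subseteq> A" for S
        using that h AB(2) by (auto simp: bij_betw_def)
      have "f P = f (h ` P)"
        using copies P AB image by (intro age_maps_copy_of[OF assms(1)]) (auto intro: finite_subset)
      moreover have "g (A - P) = g (h ` (A - P))"
        using copies AB image by (intro age_maps_copy_of[OF assms(2)]) auto
      ultimately show ?thesis by simp
    qed
    then have "age_product f g A = (\<Sum>P\<in>Pow A. f (h ` P) * g (B - h ` P))"
      unfolding age_product_def by (intro sum.cong) auto
    also have "\<dots> = age_product f g B"
      unfolding age_product_def
      by (rule sum.reindex_bij_betw[OF bij_betw_Pow[OF h], of "\<lambda>P. f P * g (B - P)"])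
    finally show "age_product f g A = age_product f g B" .
  qed
qed

lemma age_algebra_simps:
  "x \<otimes>\<^bsub>age_algebra R\<^esub> y = age_product x y"
  "x \<oplus>\<^bsub>age_algebra R\<^esub> y = (\<lambda>Q. x Q + y Q)"
  "\<one>\<^bsub>age_algebra R\<^esub> = coeff 1"
  "\<zero>\<^bsub>age_algebra R\<^esub> = coeff 0"
  by (auto simp: age_algebra_def coeff_1)

text \<open>Elements of the carrier are coefficient functions of series, so associativity,
  commutativity and the unit law are inherited from \<open>set_series\<close>.\<close>

lemma cring_age_algebra: "cring (age_algebra R)"
proof (rule cringI)
  show "abelian_group (age_algebra R)"
  proof (rule abelian_groupI)
    fix x assume "x \<in> carrier (age_algebra R)"
    then show "\<exists>y\<in>carrier (age_algebra R). y \<oplus>\<^bsub>age_algebra R\<^esub> x = \<zero>\<^bsub>age_algebra R\<^esub>"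
      by (intro bexI[of _ "\<lambda>Q. - x Q"])
        (auto simp: age_algebra_simps carrier_age_algebra age_maps_uminus)
  qed (auto simp: age_algebra_simps carrier_age_algebra age_maps_add age_maps_zero algebra_simps)
  show "Group.comm_monoid (age_algebra R)"
  proof (rule comm_monoidI)
    fix x y z
    assume "x \<in> carrier (age_algebra R)" "y \<in> carrier (age_algebra R)" "z \<in> carrier (age_algebra R)"
    then show "x \<otimes>\<^bsub>age_algebra R\<^esub> y \<otimes>\<^bsub>age_algebra R\<^esub> z =
        x \<otimes>\<^bsub>age_algebra R\<^esub> (y \<otimes>\<^bsub>age_algebra R\<^esub> z)"
      unfolding carrier_age_algebra
      by (elim age_maps_coeffE) (simp add: age_algebra_simps mult.assoc flip: coeff_mult_eq_age_product)
  next
    fix x y assume "x \<in> carrier (age_algebra R)" "y \<in> carrier (age_algebra R)"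
    then show "x \<otimes>\<^bsub>age_algebra R\<^esub> y = y \<otimes>\<^bsub>age_algebra R\<^esub> x"
      unfolding carrier_age_algebra
      by (elim age_maps_coeffE) (simp add: age_algebra_simps mult.commute flip: coeff_mult_eq_age_product)
  next
    fix x assume "x \<in> carrier (age_algebra R)"
    then show "\<one>\<^bsub>age_algebra R\<^esub> \<otimes>\<^bsub>age_algebra R\<^esub> x = x"
      unfolding carrier_age_algebra
      by (elim age_maps_coeffE) (simp add: age_algebra_simps flip: coeff_mult_eq_age_product)
  qed (simp_all add: carrier_age_algebra age_algebra_simps age_maps_mult age_maps_one)
qed (auto simp: age_algebra_simps age_product_def sum.distrib distrib_right)

section \<open>The two directions of the equivalence\<close>

text \<open>A set in the support of \<open>f\<close> has a copy disjoint from \<open>T\<close>, and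
  invariance gives that copy the same nonzero coefficient.\<close>

lemma robust_if_kernel_empty:
  assumes "kernel_of R = {}" "coeff f \<in> age_maps R" "f \<noteq> 0"
  shows "robust f"
  unfolding robust_def
proof (intro allI impI)
  fix T :: "'a set" assume "finite T"
  obtain F where F: "finite F" "coeff f F \<noteq> 0" using assms(3) by (rule nonzero_coeffE)
  then have "F \<subseteq> base R" using assms(2) by (auto simp: age_maps_def)
  then obtain F' where F': "F' \<subseteq> base R" "copy_of R F F'" "F' \<inter> T = {}"
    using copy_avoiding_finite_set assms(1) F(1) \<open>finite T\<close> by blast
  have "coeff f F' = coeff f F"
    using assms(2) F(1) \<open>F \<subseteq> base R\<close> F' by (simp add: age_maps_def)
  then have "coeff (avoid T f) F' \<noteq> coeff 0 F'" using F(2) F'(3) by (simp add: coeff_avoid)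
  then show "avoid T f \<noteq> 0" by metis
qed

lemma nilpotent_if_mem_kernel:
  assumes "x \<in> kernel_of R"
  obtains f where "f \<in> age_maps R" "f \<noteq> (\<lambda>_. 0)" "age_product f f = (\<lambda>_. 0)"
proof -
  obtain A where A: "A \<subseteq> base R" "finite A"
    and x: "\<And>B. B \<subseteq> base R \<Longrightarrow> copy_of R A B \<Longrightarrow> x \<in> B"
    using assms unfolding mem_kernel_iff by blast
  define f :: "'a set \<Rightarrow> complex"
    where "f = (\<lambda>B. if B \<subseteq> base R \<and> copy_of R A B then 1 else 0)"
  have "\<exists>d. \<forall>B. f B \<noteq> 0 \<longrightarrow> B \<subseteq> base R \<and> finite B \<and> card B \<le> d"
  proof (intro exI[of _ "card A"] allI impI)
    fix B assume "f B \<noteq> 0"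
    then have "B \<subseteq> base R" "copy_of R A B" by (auto simp: f_def split: if_splits)
    then show "B \<subseteq> base R \<and> finite B \<and> card B \<le> card A"
      using A(2) copy_of_finite[of R A B] copy_of_card[of R A B] by auto
  qed
  moreover have "copy_of R A B \<longleftrightarrow> copy_of R A C" if "copy_of R B C" for B C
    using that by (blast intro: isomorphic_sym isomorphic_trans)
  ultimately have "f \<in> age_maps R" by (auto simp: age_maps_def f_def)
  moreover have "f A \<noteq> 0" using A(1) by (simp add: f_def isomorphic_refl)
  then have "f \<noteq> (\<lambda>_. 0)" by auto
  \<comment> \<open>Both factors can be nonzero only if the disjoint sets \<open>P\<close> and
    \<open>Q - P\<close> both contain \<open>x\<close>.\<close>
  moreover have "f P * f (Q - P) = 0" for P Q
    using x[of P] x[of "Q - P"] by (auto simp: f_def)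
  then have "age_product f f = (\<lambda>_. 0)" by (simp add: age_product_def del: mult_eq_0_iff)
  ultimately show thesis by (rule that)
qed

theorem theorem1:
  fixes R :: "('a, 'i) rel_struct"
  assumes "relational_structure R"
  shows "domain (age_algebra R) \<longleftrightarrow> kernel_of R = {}"
proof
  assume "domain (age_algebra R)"
  then interpret domain "age_algebra R" .
  show "kernel_of R = {}"
  proof (rule ccontr)
    assume "kernel_of R \<noteq> {}"
    then obtain x where "x \<in> kernel_of R" by blast
    then obtain f where f: "f \<in> age_maps R" "f \<noteq> (\<lambda>_. 0)" "age_product f f = (\<lambda>_. 0)"
      by (rule nilpotent_if_mem_kernel)
    then show False
      using integral[of f f] by (auto simp: carrier_age_algebra age_algebra_simps fun_eq_iff)
  qed
next
  assume kernel: "kernel_of R = {}"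
  show "domain (age_algebra R)"
  proof (intro domain.intro domain_axioms.intro cring_age_algebra)
    show "\<one>\<^bsub>age_algebra R\<^esub> \<noteq> \<zero>\<^bsub>age_algebra R\<^esub>"
      by (simp add: age_algebra_simps coeff_inject)
    fix f g assume prod: "f \<otimes>\<^bsub>age_algebra R\<^esub> g = \<zero>\<^bsub>age_algebra R\<^esub>"
      and carrier: "f \<in> carrier (age_algebra R)" "g \<in> carrier (age_algebra R)"
    obtain u v where uv: "f = coeff u" "g = coeff v"
      using carrier[unfolded carrier_age_algebra, THEN coeff_Abs_age_map] by metis
    have "u * v = 0"
      using prod by (simp add: uv age_algebra_simps coeff_inject flip: coeff_mult_eq_age_product)
    moreover have "regular u" if "u \<noteq> 0"
    proof -
      have u: "coeff u \<in> age_maps R" using carrier(1) by (simp add: uv carrier_age_algebra)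
      then obtain d where "\<forall>Q. coeff u Q \<noteq> 0 \<longrightarrow> Q \<subseteq> base R \<and> finite Q \<and> card Q \<le> d"
        by (rule age_maps_boundE)
      then show ?thesis
        by (intro regular_if_robust[OF robust_if_kernel_empty[OF kernel u that], of d]) blast
    qed
    \<comment> \<open>A nonzero \<open>u\<close> is a non-zero-divisor among all series; the
      instance with no variable removed forces \<open>v = 0\<close>.\<close>
    ultimately have "u = 0 \<or> v = 0"
      using regularD[of u "{}" v] by auto
    then show "f = \<zero>\<^bsub>age_algebra R\<^esub> \<or> g = \<zero>\<^bsub>age_algebra R\<^esub>"
      by (auto simp: uv age_algebra_simps)
  qed
qed

end
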